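(* Let $q$ be a positive integer, let $f\in (\mathbb{Z}/q\mathbb{Z})[X]$ be a polynomial of degree $d\geqslant 2$ whose leading coefficient is coprime to $q$, and let $\mathcal{B}=(K,K+H]\times(L,L+H]$ with $K,L\in\mathbb{Z}$ be a square of side length $H$. If $$H\leqslant q^{2/(d^2+d+2)},$$ then $$\left|\{(x,y)\in \mathcal{B}\cap\mathbb{Z}^2 \ : \ y\equiv f(x) \pmod{q}\}\right|\leqslant H^{1/d+o(1)}.$$
   Context: The notation $H^{1/d+o(1)}$ means: for every $\varepsilon>0$ there is a constant $C$ depending only on $d$ and $\varepsilon$ (not on $q$, $f$, $K$, $L$) such that the quantity is at most $C H^{1/d+\varepsilon}$. The congruence $y\equiv f(x)\pmod q$ for integers $x,y$ means that $y$ and $f(x)$ have the same image in $\mathbb{Z}/q\mathbb{Z}$. *)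

theory Defs
  imports
    "HOL-Analysis.Analysis"
    "HOL-Number_Theory.Number_Theory"
begin

text \<open>
  The ring of integers modulo \<open>q\<close> is \<^term>\<open>residue_ring q\<close>, with carrier \<open>{0..q - 1}\<close>;
  the image of an integer \<open>x\<close> in it is \<open>x mod q\<close>. An element of the carrier of
  \<open>UP (residue_ring q)\<close> is a polynomial over this ring. For \<open>q = 1\<close> its only element is the
  zero polynomial, so no polynomial of positive degree exists.
\<close>

definition residue_poly_value :: "int \<Rightarrow> (nat \<Rightarrow> int) \<Rightarrow> int \<Rightarrow> int" where
  "residue_poly_value q f x = UnivPoly.eval (residue_ring q) (residue_ring q) id (x mod q) f"

definition residue_lead_coeff :: "int \<Rightarrow> (nat \<Rightarrow> int) \<Rightarrow> int" where
  "residue_lead_coeff q f = coeff (UP (residue_ring q)) f (deg (residue_ring q) f)"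

lemma residue_poly_value_eq:
  assumes q: "q > 1" and f: "f \<in> carrier (UP (residue_ring q))"
  shows "residue_poly_value q f x = (\<Sum>i\<le>deg (residue_ring q) f. f i * x ^ i) mod q"
proof -
  interpret residues q "residue_ring q"
    using q by unfold_locales auto
  have c: "coeff (UP (residue_ring q)) f = f"
    using f by (auto simp: UP_def)
  have fin: "f i \<in> carrier (residue_ring q)" for i
    using f by (auto simp: UP_def up_def)
  have m: "f i mod q = f i" for i
    using fin[of i] q by (auto simp: res_carrier_eq)
  have t: "f i \<otimes>\<^bsub>residue_ring q\<^esub> (x mod q) [^]\<^bsub>residue_ring q\<^esub> i = (f i * x ^ i) mod q" for i
    by (metis m mult_cong pow_cong)
  have "residue_poly_value q f x = 
      (\<Oplus>\<^bsub>residue_ring q\<^esub>i\<in>{..deg (residue_ring q) f}. (f i * x ^ i) mod q)"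
    using f by (simp add: residue_poly_value_def UnivPoly.eval_def c t)
  also have "\<dots> = (\<Sum>i\<le>deg (residue_ring q) f. f i * x ^ i) mod q"
    by (rule sum_cong) simp
  finally show ?thesis .
qed

definition half_open_square :: "int \<Rightarrow> int \<Rightarrow> real \<Rightarrow> (real \<times> real) set" where
  "half_open_square K L H = {of_int K<..of_int K + H} \<times> {of_int L<..of_int L + H}"

definition square_curve_points ::
  "int \<Rightarrow> (nat \<Rightarrow> int) \<Rightarrow> int \<Rightarrow> int \<Rightarrow> real \<Rightarrow> (int \<times> int) set" where
  "square_curve_points q f K L H =
     {(x, y). (of_int x, of_int y) \<in> half_open_square K L H \<and> y mod q = residue_poly_value q f x}"

end

theory Submission
  imports Defs
begin

text \<open>
  Cut the square into \<open>d + 4\<close> vertical strips of width at most \<open>H / (d + 3)\<close>. On one strip, the divided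
  difference of \<open>y\<close> over \<open>d + 2\<close> of the abscissae, multiplied by their Vandermonde product, is an
  integer divisible by \<open>q\<close>, because \<open>y\<close> is congruent to a polynomial of degree \<open>d\<close>; it is smaller than
  \<open>q\<close> because \<open>H\<close> raised to \<open>d (d + 1) / 2 + 1\<close> is at most \<open>q\<close>. So it vanishes, and all
  divided differences of order \<open>d\<close> share one rational value \<open>c\<close>, with \<open>\<bar>c\<bar> = A / D\<close> in lowest terms.
  It is nonzero because the leading coefficient is coprime to \<open>q\<close>.

  If \<open>p\<close> divides \<open>D\<close> exactly \<open>k\<close> times, the denominators in the divided difference show that among any
  \<open>d + 1\<close> abscissae two agree modulo \<open>p\<close> to the power \<open>\<lceil>k / d\<rceil>\<close>, so the abscissae occupy at most \<open>d\<close>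
  classes for this modulus. The same argument at the real place puts them into \<open>d\<close> intervals of
  length of order \<open>H powr (1 / d)\<close> times \<open>M\<close>, where \<open>M\<close>, the product of these moduli, satisfies
  \<open>M ^ d \<ge> D\<close>. Hence each of the \<open>d ^ \<omega>(D)\<close> joint classes modulo \<open>M\<close> contains
  \<open>O(H powr (1 / d))\<close> abscissae, and \<open>d ^ \<omega>(D)\<close> is at most a small power of \<open>D\<close>, which in turn
  is bounded by a fixed power of \<open>H\<close>.
\<close>

section \<open>Divided differences at integer nodes\<close>

text \<open>Newton's divided difference in Lagrange form. Indexing by a set makes it symmetric in
  the nodes and keeps them distinct.\<close>

definition divdiff :: "int set \<Rightarrow> (int \<Rightarrow> real) \<Rightarrow> real" where
  "divdiff S g = (\<Sum>x\<in>S. g x / (\<Prod>z\<in>S - {x}. real_of_int (x - z)))"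

lemma divdiff_cong: "(\<And>x. x \<in> S \<Longrightarrow> g x = h x) \<Longrightarrow> divdiff S g = divdiff S h"
  unfolding divdiff_def by (intro sum.cong) auto

lemma divdiff_add: "divdiff S (\<lambda>x. g x + h x) = divdiff S g + divdiff S h"
  by (simp add: divdiff_def add_divide_distrib sum.distrib)

lemma divdiff_cmult: "divdiff S (\<lambda>x. c * g x) = c * divdiff S g"
  by (simp add: divdiff_def sum_distrib_left)

lemma divdiff_sum: "divdiff S (\<lambda>x. \<Sum>i\<in>I. g i x) = (\<Sum>i\<in>I. divdiff S (g i))"
  unfolding divdiff_def sum_divide_distrib by (rule sum.swap)

lemma divdiff_insert:
  assumes "finite S" "a \<notin> S"
  shows "divdiff (insert a S) g =
    g a / (\<Prod>z\<in>S. real_of_int (a - z)) +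
    (\<Sum>x\<in>S. g x / (real_of_int (x - a) * (\<Prod>z\<in>S - {x}. real_of_int (x - z))))"
proof -
  have "insert a S - {a} = S" using assms by auto
  moreover have "(\<Prod>z\<in>insert a S - {x}. real_of_int (x - z)) =
      real_of_int (x - a) * (\<Prod>z\<in>S - {x}. real_of_int (x - z))" if "x \<in> S" for x
  proof -
    have "insert a S - {x} = insert a (S - {x})" using assms that by auto
    then show ?thesis using assms by simp
  qed
  ultimately show ?thesis
    using assms by (simp add: divdiff_def)
qed

text \<open>The factor \<open>x - a\<close> kills the term at \<open>a\<close> and cancels the
  factor that \<open>a\<close> adds to every other denominator.\<close>

lemma divdiff_insert_linear:
  assumes "finite S" "a \<notin> S"
  shows "divdiff (insert a S) (\<lambda>x. real_of_int (x - a) * g x) = divdiff S g"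
proof -
  have "real_of_int (x - a) * g x / (real_of_int (x - a) * (\<Prod>z\<in>S - {x}. real_of_int (x - z)))
      = g x / (\<Prod>z\<in>S - {x}. real_of_int (x - z))" if "x \<in> S" for x
    using that assms by (intro mult_divide_mult_cancel_left) auto
  then show ?thesis
    using assms by (simp add: divdiff_insert) (simp add: divdiff_def)
qed

text \<open>Newton's recurrence: in \<open>a - b = (x - b) - (x - a)\<close> each summand removes
  one node by \<open>divdiff_insert_linear\<close>.\<close>

lemma divdiff_insert_insert:
  assumes "finite S" "a \<notin> S" "b \<notin> S" "a \<noteq> b"
  shows "real_of_int (a - b) * divdiff (insert a (insert b S)) g =
    divdiff (insert a S) g - divdiff (insert b S) g"
proof -
  have "real_of_int (a - b) * divdiff (insert a (insert b S)) g =
      divdiff (insert a (insert b S)) (\<lambda>x. real_of_int (x - b) * g x) +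
      divdiff (insert a (insert b S)) (\<lambda>x. - 1 * (real_of_int (x - a) * g x))"
    unfolding divdiff_add[symmetric] divdiff_cmult[symmetric]
    by (intro divdiff_cong) (simp add: algebra_simps)
  also have "divdiff (insert a (insert b S)) (\<lambda>x. - 1 * (real_of_int (x - a) * g x)) =
      - 1 * divdiff (insert b S) g"
    using assms by (subst divdiff_cmult, subst divdiff_insert_linear) auto
  also have "divdiff (insert a (insert b S)) (\<lambda>x. real_of_int (x - b) * g x) =
      divdiff (insert a S) g"
    using assms by (subst insert_commute, subst divdiff_insert_linear) auto
  finally show ?thesis by simp
qed

text \<open>For at least two nodes the recurrence gives a difference of two equal values: both 1 for
  two nodes, both 0 for more.\<close>

lemma divdiff_one:
  assumes "finite S" "S \<noteq> {}"
  shows "divdiff S (\<lambda>x. 1) = (if card S = 1 then 1 else 0)"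
  using assms
proof (induction "card S" arbitrary: S rule: less_induct)
  case less
  show ?case
  proof (cases "card S = 1")
    case True
    then obtain a where "S = {a}" by (auto simp: card_1_singleton_iff)
    then show ?thesis by (simp add: divdiff_def)
  next
    case False
    with less.prems have "card S \<ge> 2"
      by (metis One_nat_def Suc_1 card_gt_0_iff le_eq_less_or_eq less_Suc_eq_le not_less_eq)
    then obtain a b where ab: "a \<in> S" "b \<in> S" "a \<noteq> b"
      using card_le_Suc0_iff_eq[of S] less.prems by force
    define T where "T = S - {a, b}"
    have S: "S = insert a (insert b T)" and T: "finite T" "a \<notin> T" "b \<notin> T"
      using ab less.prems by (auto simp: T_def)
    have "divdiff (insert a T) (\<lambda>x. 1) = divdiff (insert b T) (\<lambda>x. 1)"
      using less.hyps[of "insert a T"] less.hyps[of "insert b T"] T ab(3) unfolding S by simp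
    then have "real_of_int (a - b) * divdiff S (\<lambda>x. 1) = 0"
      unfolding S using divdiff_insert_insert[OF T ab(3)] by simp
    then show ?thesis using ab False by simp
  qed
qed

text \<open>Induction via \<open>x ^ Suc k = (x - a) * x ^ k + a * x ^ k\<close>: the first summand
  loses the node \<open>a\<close>, the second contributes 0 because \<open>S\<close> has more than
  \<open>k + 1\<close> nodes.\<close>

lemma divdiff_power:
  assumes "finite S" "k < card S"
  shows "divdiff S (\<lambda>x. real_of_int x ^ k) = (if card S = k + 1 then 1 else 0)"
  using assms
proof (induction k arbitrary: S)
  case 0
  then have "S \<noteq> {}" by auto
  with 0 show ?case using divdiff_one[of S] by simp
next
  case (Suc k)
  then obtain a where "a \<in> S" by fastforce
  define T where "T = S - {a}"
  have S: "S = insert a T" and T: "finite T" "a \<notin> T"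
    using \<open>a \<in> S\<close> Suc.prems by (auto simp: T_def)
  have "divdiff S (\<lambda>x. real_of_int x ^ Suc k) =
      divdiff S (\<lambda>x. real_of_int (x - a) * real_of_int x ^ k + real_of_int a * real_of_int x ^ k)"
    by (intro divdiff_cong) (simp add: algebra_simps)
  also have "\<dots> = divdiff T (\<lambda>x. real_of_int x ^ k) + real_of_int a * divdiff S (\<lambda>x. real_of_int x ^ k)"
    unfolding divdiff_add divdiff_cmult using divdiff_insert_linear[OF T, of "\<lambda>x. real_of_int x ^ k"]
    by (simp only: S)
  also have "\<dots> = (if card S = Suc k + 1 then 1 else 0)"
    using Suc.IH[of T] Suc.IH[of S] Suc.prems T by (simp add: S)
  finally show ?case .
qed

lemma divdiff_poly:
  assumes "finite S" "d < card S"
  shows "divdiff S (\<lambda>x. \<Sum>i\<le>d. a i * real_of_int x ^ i) = (if card S = d + 1 then a d else 0)"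
proof -
  have "divdiff S (\<lambda>x. \<Sum>i\<le>d. a i * real_of_int x ^ i) =
      (\<Sum>i\<le>d. if i = d then (if card S = d + 1 then a d else 0) else 0)"
    unfolding divdiff_sum divdiff_cmult
  proof (intro sum.cong refl)
    fix i assume "i \<in> {..d}"
    with assms have "divdiff S (\<lambda>x. real_of_int x ^ i) = (if card S = i + 1 then 1 else 0)"
      by (intro divdiff_power) auto
    then show "a i * divdiff S (\<lambda>x. real_of_int x ^ i) =
        (if i = d then (if card S = d + 1 then a d else 0) else 0)"
      using assms \<open>i \<in> {..d}\<close> by auto
  qed
  then show ?thesis by simp
qed

text \<open>\<open>S\<close> is turned into \<open>T\<close> by exchanging one node \<open>a\<close>
  for one node \<open>b\<close> at a time. By the recurrence the value changes by a multiple of the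
  divided difference over \<open>n + 2\<close> nodes, which is zero.\<close>

lemma divdiff_eq_if_next_vanishes:
  assumes X: "\<And>S. S \<subseteq> X \<Longrightarrow> card S = n + 2 \<Longrightarrow> divdiff S g = 0"
    and "S \<subseteq> X" "T \<subseteq> X" "card S = n + 1" "card T = n + 1"
  shows "divdiff S g = divdiff T g"
  using assms(2-)
proof (induction "card (S - T)" arbitrary: S)
  case 0
  then have "finite S" "finite T" by (auto intro: card_ge_0_finite)
  with 0 have "S \<subseteq> T" by auto
  with 0 \<open>finite T\<close> have "S = T" by (intro card_subset_eq) auto
  then show ?case by simp
next
  case (Suc m)
  have fin: "finite S" "finite T" using Suc.prems by (auto intro: card_ge_0_finite)
  from Suc.hyps(2) obtain a where a: "a \<in> S" "a \<notin> T"
    by (metis Diff_iff card.empty ex_in_conv nat.distinct(1))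
  have "card (T - S) = card (S - T)"
    using fin Suc.prems by (simp add: card_Diff_subset_Int Int_commute)
  then obtain b where b: "b \<in> T" "b \<notin> S"
    using Suc.hyps(2) by (metis Diff_iff card.empty ex_in_conv nat.distinct(1))
  define R where "R = S - {a}"
  have R: "finite R" "a \<notin> R" "b \<notin> R" "a \<noteq> b" and S: "S = insert a R"
    using a b fin by (auto simp: R_def)
  have cR: "card R = n" using Suc.prems R S by simp
  have "divdiff (insert a (insert b R)) g = 0"
    using R cR S b Suc.prems by (intro X) auto
  then have "divdiff S g = divdiff (insert b R) g"
    using divdiff_insert_insert[OF R, of g] S by simp
  also have "\<dots> = divdiff T g"
  proof (rule Suc.hyps(1))
    have "insert b R - T = (S - T) - {a}" using a b by (auto simp: R_def)
    then show "m = card (insert b R - T)" using Suc.hyps(2) a fin by simp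
  qed (use Suc.prems b R cR S in auto)
  finally show ?case .
qed

section \<open>Vandermonde products as common denominators\<close>

text \<open>The absolute value of the Vandermonde determinant: the condition \<open>z < x\<close>
  takes each pair once and makes every factor positive.\<close>

definition diffprod :: "int set \<Rightarrow> int" where
  "diffprod S = (\<Prod>x\<in>S. \<Prod>z\<in>{z \<in> S. z < x}. x - z)"

lemma diffprod_pos: "diffprod S > 0"
  unfolding diffprod_def by (intro prod_pos) auto

lemma diffprod_insert:
  assumes "finite S" "a \<notin> S"
  shows "diffprod (insert a S) = diffprod S * (\<Prod>z\<in>S. \<bar>a - z\<bar>)"
proof -
  have 1: "{z \<in> insert a S. z < a} = {z \<in> S. z < a}" by auto
  have 2: "(\<Prod>z\<in>{z \<in> insert a S. z < x}. x - z) =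
      (if a < x then x - a else 1) * (\<Prod>z\<in>{z \<in> S. z < x}. x - z)" for x
  proof (cases "a < x")
    case True
    then have "{z \<in> insert a S. z < x} = insert a {z \<in> S. z < x}" by auto
    then show ?thesis using True assms by simp
  next
    case False
    then have "{z \<in> insert a S. z < x} = {z \<in> S. z < x}" by auto
    then show ?thesis using False by simp
  qed
  have 3: "(\<Prod>z\<in>{z \<in> S. z < a}. a - z) = (\<Prod>z\<in>S. if z < a then a - z else 1)"
    using assms by (simp add: prod.inter_filter)
  have "diffprod (insert a S) = (\<Prod>z\<in>{z \<in> S. z < a}. a - z) *
      ((\<Prod>x\<in>S. if a < x then x - a else 1) * diffprod S)"
    unfolding diffprod_def prod.insert[OF assms] 2 by (simp add: prod.distrib)
  also have "\<dots> = diffprod S * (\<Prod>z\<in>S. (if z < a then a - z else 1) * (if a < z then z - a else 1))"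
    by (simp add: 3 prod.distrib)
  also have "(\<Prod>z\<in>S. (if z < a then a - z else 1) * (if a < z then z - a else 1)) = (\<Prod>z\<in>S. \<bar>a - z\<bar>)"
    using assms by (intro prod.cong) auto
  finally show ?thesis .
qed

lemma diffprod_le:
  assumes "finite S" "0 \<le> B" "\<And>x z. x \<in> S \<Longrightarrow> z \<in> S \<Longrightarrow> \<bar>real_of_int (x - z)\<bar> \<le> B"
  shows "real_of_int (diffprod S) \<le> B ^ (card S choose 2)"
  using assms
proof (induction S rule: finite_induct)
  case empty
  then show ?case by (simp add: diffprod_def numeral_2_eq_2)
next
  case (insert a S)
  have "real_of_int (\<Prod>z\<in>S. \<bar>a - z\<bar>) \<le> (\<Prod>z\<in>S. B)"
    unfolding of_int_prod using insert.prems by (intro prod_mono) auto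
  moreover have "real_of_int (diffprod S) \<le> B ^ (card S choose 2)"
    using insert.prems by (intro insert.IH) auto
  moreover have "0 \<le> real_of_int (\<Prod>z\<in>S. \<bar>a - z\<bar>)"
    by (simp add: prod_nonneg)
  ultimately have "real_of_int (diffprod S) * real_of_int (\<Prod>z\<in>S. \<bar>a - z\<bar>) \<le> B ^ (card S choose 2) * B ^ card S"
    using insert.prems by (intro mult_mono) auto
  also have "\<dots> = B ^ (card (insert a S) choose 2)"
    using insert.hyps by (simp add: numeral_2_eq_2 power_add mult.commute)
  finally show ?case
    using insert.hyps by (simp add: diffprod_insert)
qed

text \<open>For \<open>x\<close> in \<open>S\<close> this is the quotient of
  \<open>diffprod S\<close> by the denominator at \<open>x\<close>. Written without division, it is
  visibly an integer, with the size of a Vandermonde product over one node fewer.\<close>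

definition cofactor :: "int set \<Rightarrow> int \<Rightarrow> int" where
  "cofactor S x = sgn (\<Prod>z\<in>S - {x}. x - z) * diffprod (S - {x})"

lemma abs_cofactor:
  assumes "finite S"
  shows "\<bar>cofactor S x\<bar> = diffprod (S - {x})"
proof -
  have "(\<Prod>z\<in>S - {x}. x - z) \<noteq> 0" using assms by auto
  then show ?thesis
    using diffprod_pos[of "S - {x}"] by (simp add: cofactor_def abs_mult abs_sgn_eq)
qed

lemma diffprod_eq_cofactor:
  assumes "finite S" "x \<in> S"
  shows "diffprod S = cofactor S x * (\<Prod>z\<in>S - {x}. x - z)"
proof -
  have "diffprod S = diffprod (S - {x}) * \<bar>\<Prod>z\<in>S - {x}. x - z\<bar>"
    using diffprod_insert[of "S - {x}" x] assms by (simp add: insert_absorb abs_prod)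
  then show ?thesis
    by (simp add: cofactor_def abs_sgn[of "\<Prod>z\<in>S - {x}. x - z"] mult_ac)
qed

text \<open>Clearing denominators turns a divided difference of integers into an integer, which can
  be studied modulo \<open>q\<close>.\<close>

lemma diffprod_mult_divdiff:
  assumes "finite S"
  shows "real_of_int (diffprod S) * divdiff S g = (\<Sum>x\<in>S. real_of_int (cofactor S x) * g x)"
proof -
  have "real_of_int (diffprod S) * (g x / (\<Prod>z\<in>S - {x}. real_of_int (x - z))) =
      real_of_int (cofactor S x) * g x" if "x \<in> S" for x
  proof -
    have "(\<Prod>z\<in>S - {x}. real_of_int (x - z)) \<noteq> 0" using assms by auto
    then show ?thesis
      using assms that by (simp add: diffprod_eq_cofactor[of S x] del: of_int_diff)
  qed
  then show ?thesis
    by (simp add: divdiff_def sum_distrib_left)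
qed

lemma diffprod_mult_divdiff_int:
  assumes "finite S"
  shows "real_of_int (diffprod S) * divdiff S (\<lambda>x. real_of_int (g x)) =
    real_of_int (\<Sum>x\<in>S. cofactor S x * g x)"
  using assms by (simp add: diffprod_mult_divdiff)

section \<open>Nodes that are close at a finite or the real place\<close>

text \<open>A set of pairwise unrelated elements is built greedily; by \<open>pair\<close> it cannot
  have \<open>d + 1\<close> members. Transitivity is not assumed, so that the relation of having
  distance at most \<open>s\<close> is covered too.\<close>

lemma exists_covering_set:
  assumes "finite X" "reflp R" "symp R"
    and pair: "\<And>S. S \<subseteq> X \<Longrightarrow> card S = d + 1 \<Longrightarrow> \<exists>x\<in>S. \<exists>z\<in>S. x \<noteq> z \<and> R x z"
  obtains T where "T \<subseteq> X" "card T \<le> d" "\<And>x. x \<in> X \<Longrightarrow> \<exists>t\<in>T. R x t"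
proof -
  have "\<exists>T\<subseteq>X. (\<forall>x\<in>T. \<forall>z\<in>T. R x z \<longrightarrow> x = z) \<and> (\<forall>x\<in>X. \<exists>t\<in>T. R x t)"
    using \<open>finite X\<close>
  proof (induction X rule: finite_induct)
    case (insert a X)
    obtain T where T: "T \<subseteq> X" "\<forall>x\<in>T. \<forall>z\<in>T. R x z \<longrightarrow> x = z" "\<forall>x\<in>X. \<exists>t\<in>T. R x t"
      using insert.IH by (elim exE conjE)
    show ?case
    proof (cases "\<exists>t\<in>T. R a t")
      case True
      then show ?thesis using T by (intro exI[of _ T]) auto
    next
      case False
      then have "\<forall>t\<in>T. \<not> R a t \<and> \<not> R t a"
        using \<open>symp R\<close> by (auto dest: sympD)
      moreover have "R a a" using \<open>reflp R\<close> by (auto dest: reflpD)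
      ultimately show ?thesis
        using T by (intro exI[of _ "insert a T"]) auto
    qed
  qed auto
  then obtain T where T: "T \<subseteq> X" "\<forall>x\<in>T. \<forall>z\<in>T. R x z \<longrightarrow> x = z" "\<forall>x\<in>X. \<exists>t\<in>T. R x t"
    by (elim exE conjE)
  have "card T \<le> d"
  proof (rule ccontr)
    assume "\<not> card T \<le> d"
    then obtain S where S: "S \<subseteq> T" "card S = d + 1"
      using obtain_subset_with_card_n[of "d + 1" T] by auto
    then obtain x z where "x \<in> S" "z \<in> S" "x \<noteq> z" "R x z"
      using pair[of S] T(1) by auto
    with S T(2) show False by auto
  qed
  with T show thesis by (intro that[of T]) auto
qed

text \<open>Dividing the offsets from the least element by \<open>M\<close> is injective, and these
  offsets are at most \<open>2 * s\<close>.\<close>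

lemma card_residue_class_in_interval:
  fixes t :: int and s :: real and M :: nat
  assumes "finite Y" "M > 0" "s \<ge> 0"
    and cong: "\<And>x z. x \<in> Y \<Longrightarrow> z \<in> Y \<Longrightarrow> int M dvd x - z"
    and near: "\<And>x. x \<in> Y \<Longrightarrow> \<bar>real_of_int (x - t)\<bar> \<le> s"
  shows "real (card Y) \<le> 2 * s / real M + 1"
proof (cases "Y = {}")
  case True
  with assms show ?thesis by simp
next
  case False
  define a where "a = Min Y"
  have a: "a \<in> Y" "\<And>x. x \<in> Y \<Longrightarrow> a \<le> x"
    using False assms by (auto simp: a_def)
  define N where "N = \<lfloor>2 * s / real M\<rfloor>"
  have "N \<ge> 0" using assms by (simp add: N_def)
  have "inj_on (\<lambda>x. (x - a) div int M) Y"
  proof (rule inj_onI)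
    fix x z assume xz: "x \<in> Y" "z \<in> Y" "(x - a) div int M = (z - a) div int M"
    then have "x - a = z - a"
      using cong[OF xz(1) a(1)] cong[OF xz(2) a(1)] by (metis dvd_mult_div_cancel)
    then show "x = z" by simp
  qed
  moreover have "(\<lambda>x. (x - a) div int M) ` Y \<subseteq> {0..N}"
  proof
    fix k assume "k \<in> (\<lambda>x. (x - a) div int M) ` Y"
    then obtain x where x: "x \<in> Y" "k = (x - a) div int M" by auto
    have "x - a = int M * k" using cong[OF x(1) a(1)] x(2) by simp
    then have "real M * real_of_int k = real_of_int (x - t) - real_of_int (a - t)"
      by (metis diff_diff_eq2 diff_add_cancel of_int_diff of_int_mult of_int_of_nat_eq)
    also have "\<dots> \<le> 2 * s" using near[OF x(1)] near[OF a(1)] by linarith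
    finally have "real_of_int k \<le> 2 * s / real M"
      using \<open>M > 0\<close> by (simp add: field_simps)
    then have "k \<le> N" by (simp add: N_def le_floor_iff)
    moreover have "0 \<le> k" using x a \<open>M > 0\<close> by (simp add: pos_imp_zdiv_nonneg_iff)
    ultimately show "k \<in> {0..N}" by simp
  qed
  ultimately have "card Y \<le> card {0..N}"
    by (intro card_inj_on_le) auto
  then have "real (card Y) \<le> real_of_int N + 1" using \<open>N \<ge> 0\<close> by simp
  also have "\<dots> \<le> 2 * s / real M + 1" by (simp add: N_def)
  finally show ?thesis .
qed

text \<open>The maximal ideal of the integers localized at \<open>p\<close> is closed under
  addition; this serves as the ultrametric inequality.\<close>

lemma sum_locally_divisible:
  fixes p :: int
  assumes "prime p" "finite S"
    and "\<And>x. x \<in> S \<Longrightarrow> \<exists>a b. \<not> p dvd b \<and> g x = real_of_int (p * a) / real_of_int b"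
  shows "\<exists>a b. \<not> p dvd b \<and> (\<Sum>x\<in>S. g x) = real_of_int (p * a) / real_of_int b"
  using assms(2,3)
proof (induction S rule: finite_induct)
  case empty
  have "\<not> p dvd 1" using \<open>prime p\<close> not_prime_unit by blast
  then show ?case by (intro exI[of _ 0] exI[of _ 1]) auto
next
  case (insert x S)
  obtain a b where ab: "\<not> p dvd b" "(\<Sum>x\<in>S. g x) = real_of_int (p * a) / real_of_int b"
    using insert.IH insert.prems by force
  obtain a' b' where ab': "\<not> p dvd b'" "g x = real_of_int (p * a') / real_of_int b'"
    using insert.prems by force
  have nz: "b \<noteq> 0" "b' \<noteq> 0" using ab ab' by auto
  have "\<not> p dvd b * b'" using ab ab' \<open>prime p\<close> by (simp add: prime_dvd_mult_iff)
  moreover have "(\<Sum>x\<in>insert x S. g x) = real_of_int (p * (a' * b + a * b')) / real_of_int (b * b')"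
    using insert.hyps nz ab ab' by (simp add: field_simps)
  ultimately show ?case by blast
qed

text \<open>
  The \<open>p\<close>-adic counterpart of the trivial bound for a divided difference: a denominator divisible
  by a high power of \<open>p\<close> forces two of the nodes to be \<open>p\<close>-adically close.
\<close>

lemma divdiff_nodes_close_padic:
  fixes p D A :: nat and y :: "int \<Rightarrow> int"
  assumes p: "prime p" and "p ^ k dvd D" "k > 0" "coprime A D" "D > 0"
    and S: "finite S" "card S = d + 1"
    and c: "\<bar>divdiff S (\<lambda>x. real_of_int (y x))\<bar> = real A / real D"
    and e: "e > 0" "d * (e - 1) < k"
  shows "\<exists>x\<in>S. \<exists>z\<in>S. x \<noteq> z \<and> int (p ^ e) dvd x - z"
proof (rule ccontr)
  assume contra: "\<not> ?thesis"
  have p': "prime (int p)" using p by simp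
  \<comment> \<open>If no two nodes agree modulo \<open>p ^ e\<close>, each of the \<open>d\<close>
    differences at \<open>x\<close> has multiplicity at most \<open>e - 1\<close>, so the
    denominator contains fewer than \<open>k\<close> factors \<open>p\<close>. Multiplying by
    \<open>D\<close> then leaves a factor \<open>p\<close> in the numerator.\<close>
  have "\<exists>a b. \<not> int p dvd b \<and>
      real D * (real_of_int (y x) / (\<Prod>z\<in>S - {x}. real_of_int (x - z))) = real_of_int (int p * a) / real_of_int b"
    if x: "x \<in> S" for x
  proof -
    define W where "W = (\<Prod>z\<in>S - {x}. x - z)"
    have W0: "W \<noteq> 0" using S by (simp add: W_def)
    have "multiplicity (int p) W = (\<Sum>z\<in>S - {x}. multiplicity (int p) (x - z))"
      unfolding W_def using S p' by (intro prime_elem_multiplicity_prod_distrib) auto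
    also have "\<dots> \<le> (\<Sum>z\<in>S - {x}. e - 1)"
    proof (intro sum_mono)
      fix z assume z: "z \<in> S - {x}"
      then have "\<not> int p ^ e dvd x - z" using contra x by auto
      then have "multiplicity (int p) (x - z) < e"
        using z p' by (meson DiffD2 multiplicity_dvd' not_le)
      then show "multiplicity (int p) (x - z) \<le> e - 1" by simp
    qed
    also have "\<dots> = d * (e - 1)" using S x by simp
    finally have m: "multiplicity (int p) W < k" using e by simp
    obtain u where u: "W = int p ^ multiplicity (int p) W * u" "\<not> int p dvd u"
      using multiplicity_decompose'[of W "int p"] W0 p' by (metis not_prime_unit)
    have "p ^ Suc (multiplicity (int p) W) dvd D"
      using m assms(2) by (meson Suc_leI dvd_trans le_imp_power_dvd)
    then obtain D' where D': "D = p ^ Suc (multiplicity (int p) W) * D'" by blast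
    have nz: "real p ^ multiplicity (int p) W \<noteq> 0" "real_of_int u \<noteq> 0"
      using u p by auto
    have "(\<Prod>z\<in>S - {x}. real_of_int (x - z)) = real_of_int W"
      by (simp add: W_def)
    also have "\<dots> = real p ^ multiplicity (int p) W * real_of_int u"
      by (subst u(1)) simp
    finally have "real D * (real_of_int (y x) / (\<Prod>z\<in>S - {x}. real_of_int (x - z))) =
        real_of_int (int p * (int D' * y x)) / real_of_int u"
      using nz by (subst D') simp
    then show ?thesis using u(2) by blast
  qed
  then have "\<exists>a b. \<not> int p dvd b \<and>
      (\<Sum>x\<in>S. real D * (real_of_int (y x) / (\<Prod>z\<in>S - {x}. real_of_int (x - z)))) =
      real_of_int (int p * a) / real_of_int b"
    by (intro sum_locally_divisible p' S) auto
  then obtain a b where ab: "\<not> int p dvd b"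
    "real D * divdiff S (\<lambda>x. real_of_int (y x)) = real_of_int (int p * a) / real_of_int b"
    by (auto simp: divdiff_def sum_distrib_left)
  \<comment> \<open>Up to sign the sum is \<open>A\<close>, so \<open>p\<close> divides both
    \<open>A\<close> and \<open>D\<close>, against coprimality.\<close>
  have "real A = real D * \<bar>divdiff S (\<lambda>x. real_of_int (y x))\<bar>"
    using c \<open>D > 0\<close> by simp
  also have "\<dots> = \<bar>real_of_int (int p * a) / real_of_int b\<bar>"
    unfolding ab(2)[symmetric] by (simp add: abs_mult)
  finally have "real A * \<bar>real_of_int b\<bar> = real p * \<bar>real_of_int a\<bar>"
    using ab(1) by (auto simp: field_simps abs_mult)
  then have "int A * \<bar>b\<bar> = int p * \<bar>a\<bar>"
    by (metis of_int_abs of_int_eq_iff of_int_mult of_int_of_nat_eq)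
  then have "int p dvd int A * \<bar>b\<bar>" by simp
  then have "p dvd A" using ab(1) p' by (simp add: prime_dvd_mult_iff)
  moreover have "p dvd D" using \<open>p ^ k dvd D\<close> \<open>k > 0\<close> by (meson dvd_power dvd_trans)
  ultimately show False
    using \<open>coprime A D\<close> p by (metis coprime_common_divisor_nat not_prime_1)
qed

text \<open>If all distances exceeded \<open>s\<close>, each of the \<open>d + 1\<close> terms would
  be at most \<open>H / s ^ d\<close>.\<close>

lemma divdiff_nodes_close_real:
  assumes S: "finite S" "card S = d + 1" and "s > 0"
    and H: "\<And>x. x \<in> S \<Longrightarrow> \<bar>g x\<bar> \<le> H"
    and c: "(real d + 1) * H < \<bar>divdiff S g\<bar> * s ^ d"
  shows "\<exists>x\<in>S. \<exists>z\<in>S. x \<noteq> z \<and> \<bar>real_of_int (x - z)\<bar> \<le> s"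
proof (rule ccontr)
  assume contra: "\<not> ?thesis"
  have "\<bar>divdiff S g\<bar> \<le> (\<Sum>x\<in>S. \<bar>g x / (\<Prod>z\<in>S - {x}. real_of_int (x - z))\<bar>)"
    unfolding divdiff_def by (rule sum_abs)
  also have "\<dots> \<le> (\<Sum>x\<in>S. H / s ^ d)"
  proof (intro sum_mono)
    fix x assume x: "x \<in> S"
    have "(\<Prod>z\<in>S - {x}. s) \<le> (\<Prod>z\<in>S - {x}. \<bar>real_of_int (x - z)\<bar>)"
      using contra x \<open>s > 0\<close> by (intro prod_mono) force
    then have "s ^ d \<le> \<bar>\<Prod>z\<in>S - {x}. real_of_int (x - z)\<bar>"
      using S x by (simp add: abs_prod)
    then have "\<bar>g x\<bar> / \<bar>\<Prod>z\<in>S - {x}. real_of_int (x - z)\<bar> \<le> H / s ^ d"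
      using H[OF x] \<open>s > 0\<close> by (intro frac_le) auto
    then show "\<bar>g x / (\<Prod>z\<in>S - {x}. real_of_int (x - z))\<bar> \<le> H / s ^ d"
      by (simp only: abs_divide)
  qed
  also have "\<dots> = (real d + 1) * H / s ^ d" using S by simp
  finally show False using c \<open>s > 0\<close> by (simp add: field_simps)
qed

text \<open>The least \<open>M\<close> with \<open>D dvd M ^ d\<close>; truncated subtraction is harmless since multiplicities here are positive.\<close>

definition root_ceil :: "nat \<Rightarrow> nat \<Rightarrow> nat" where
  "root_ceil d D = (\<Prod>p\<in>prime_factors D. p ^ ((multiplicity p D + d - 1) div d))"

lemma root_ceil_pos: "root_ceil d D > 0"
  unfolding root_ceil_def by (intro prod_pos) (auto dest!: in_prime_factors_imp_prime simp: prime_gt_0_nat)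

lemma le_root_ceil_power:
  assumes "d > 0" "D > 0"
  shows "D \<le> root_ceil d D ^ d"
proof -
  have "D = (\<Prod>p\<in>prime_factors D. p ^ multiplicity p D)"
    using assms by (simp add: prod_prime_factors)
  also have "\<dots> \<le> (\<Prod>p\<in>prime_factors D. (p ^ ((multiplicity p D + d - 1) div d)) ^ d)"
  proof (intro prod_mono conjI)
    fix p assume "p \<in> prime_factors D"
    then have "p \<ge> 1" using in_prime_factors_imp_prime prime_ge_1_nat by blast
    have "multiplicity p D + d - 1 < ((multiplicity p D + d - 1) div d + 1) * d"
      using assms by (simp add: dividend_less_div_times)
    then have "multiplicity p D \<le> (multiplicity p D + d - 1) div d * d"
      using assms by (simp add: algebra_simps)
    with \<open>p \<ge> 1\<close> show "p ^ multiplicity p D \<le> (p ^ ((multiplicity p D + d - 1) div d)) ^ d"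
      unfolding power_mult[symmetric] by (intro power_increasing) auto
  qed auto
  finally show ?thesis
    by (simp add: root_ceil_def prod_power_distrib)
qed

lemma prod_coprime_dvd:
  fixes f :: "'a \<Rightarrow> int"
  assumes "finite P" "\<And>p q. p \<in> P \<Longrightarrow> q \<in> P \<Longrightarrow> p \<noteq> q \<Longrightarrow> coprime (f p) (f q)"
    and "\<And>p. p \<in> P \<Longrightarrow> f p dvd n"
  shows "(\<Prod>p\<in>P. f p) dvd n"
  using assms
proof (induction P rule: finite_induct)
  case (insert a P)
  then have "coprime (f a) (\<Prod>p\<in>P. f p)"
    by (intro prod_coprime_right) auto
  with insert show ?case by (auto intro!: divides_mult)
qed auto

text \<open>Powers of different primes are coprime, so the congruences at the single primes combine
  into one.\<close>

lemma root_ceil_dvd: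
  assumes "\<And>p. p \<in> prime_factors D \<Longrightarrow> int (p ^ ((multiplicity p D + d - 1) div d)) dvd n"
  shows "int (root_ceil d D) dvd n"
  unfolding root_ceil_def of_nat_prod
proof (rule prod_coprime_dvd)
  fix p q assume "p \<in> prime_factors D" "q \<in> prime_factors D" "p \<noteq> q"
  then have "coprime p q" by (intro primes_coprime) auto
  then show "coprime (int (p ^ ((multiplicity p D + d - 1) div d)))
      (int (q ^ ((multiplicity q D + d - 1) div d)))"
    by (simp add: coprime_power_left_iff coprime_power_right_iff)
qed (use assms in auto)

section \<open>Counting nodes with constant divided differences\<close>

lemma card_le_by_fibres:
  assumes "finite B" "\<tau> ` X \<subseteq> B" "\<And>b. b \<in> B \<Longrightarrow> real (card {x \<in> X. \<tau> x = b}) \<le> c"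
  shows "real (card X) \<le> real (card B) * c"
proof -
  have "X = (\<Union>b\<in>B. {x \<in> X. \<tau> x = b})" using assms by auto
  then have "card X \<le> (\<Sum>b\<in>B. card {x \<in> X. \<tau> x = b})"
    using card_UN_le[OF assms(1), of "\<lambda>b. {x \<in> X. \<tau> x = b}"] by simp
  then have "real (card X) \<le> (\<Sum>b\<in>B. real (card {x \<in> X. \<tau> x = b}))"
    by (metis of_nat_le_iff of_nat_sum)
  also have "\<dots> \<le> (\<Sum>b\<in>B. c)" using assms by (intro sum_mono) auto
  finally show ?thesis by simp
qed

text \<open>A small divided difference permits distant nodes, but its denominator forces
  congruences. As \<open>D \<le> M ^ d\<close>, the interval length grows only in proportion to
  \<open>M\<close>, which the spacing \<open>M\<close> inside a residue class cancels.\<close>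

lemma card_constant_divdiff:
  fixes y :: "int \<Rightarrow> int" and A D :: nat
  assumes "finite X" "d > 0" "H \<ge> 1" "A > 0" "D > 0" "coprime A D"
    and c: "\<And>S. S \<subseteq> X \<Longrightarrow> card S = d + 1 \<Longrightarrow> \<bar>divdiff S (\<lambda>x. real_of_int (y x))\<bar> = real A / real D"
    and y: "\<And>x. x \<in> X \<Longrightarrow> \<bar>real_of_int (y x)\<bar> \<le> H"
  shows "real (card X) \<le> real d ^ card (prime_factors D) *
    (real d * (4 * (real d + 1) * H powr (1 / real d) + 1))"
proof -
  define M where "M = root_ceil d D"
  define e where "e = (\<lambda>p. (multiplicity p D + d - 1) div d)"
  define h where "h = H powr (1 / real d)"
  \<comment> \<open>This gives \<open>s ^ d \<ge> 2 * (d + 1) * H * D\<close>, twice what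
    \<open>divdiff_nodes_close_real\<close> needs when \<open>A = 1\<close>, while
    \<open>2 * s / M\<close> is free of \<open>M\<close>.\<close>
  define s where "s = 2 * (real d + 1) * h * real M"
  have M: "M > 0" "D \<le> M ^ d"
    using root_ceil_pos le_root_ceil_power assms by (auto simp: M_def)
  have h: "h > 0" "h ^ d = H" using assms by (auto simp: h_def powr_realpow[symmetric] powr_powr)
  have s: "s > 0" using h M by (simp add: s_def)
  have "\<exists>T\<subseteq>X. card T \<le> d \<and> (\<forall>x\<in>X. \<exists>t\<in>T. int (p ^ e p) dvd x - t)"
    if "p \<in> prime_factors D" for p
  proof -
    have k: "multiplicity p D > 0" "prime p" "p dvd D"
      using that in_prime_factors_imp_dvd[OF that] by (auto simp: prime_factors_multiplicity)
    have "e p > 0" using k assms(2) by (auto simp: e_def div_greater_zero_iff)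
    have "e p * d \<le> multiplicity p D + d - 1" by (simp add: e_def)
    \<comment> \<open>\<open>e p\<close> is the ceiling of the multiplicity over \<open>d\<close>,
      the largest exponent satisfying this inequality.\<close>
    then have "d * (e p - 1) < multiplicity p D"
      using k(1) \<open>e p > 0\<close> by (auto simp: algebra_simps diff_mult_distrib2)
    then have "\<exists>x\<in>S. \<exists>z\<in>S. x \<noteq> z \<and> int (p ^ e p) dvd x - z" if "S \<subseteq> X" "card S = d + 1" for S
      using k assms \<open>e p > 0\<close> that c[OF that] finite_subset[OF that(1)]
      by (intro divdiff_nodes_close_padic[of p "multiplicity p D" D A S d y "e p"])
         (auto simp: multiplicity_dvd)
    moreover have "reflp (\<lambda>x z. int (p ^ e p) dvd x - z)" by (auto intro: reflpI)
    moreover have "symp (\<lambda>x z. int (p ^ e p) dvd x - z)" by (auto intro!: sympI simp: dvd_diff_commute)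
    ultimately show ?thesis
      using exists_covering_set[OF \<open>finite X\<close>, of "\<lambda>x z. int (p ^ e p) dvd x - z" d] by metis
  qed
  then obtain T where T: "\<And>p. p \<in> prime_factors D \<Longrightarrow> T p \<subseteq> X \<and> card (T p) \<le> d \<and>
      (\<forall>x\<in>X. \<exists>t\<in>T p. int (p ^ e p) dvd x - t)"
    by metis
  then obtain \<tau> where \<tau>: "\<And>p x. p \<in> prime_factors D \<Longrightarrow> x \<in> X \<Longrightarrow> \<tau> p x \<in> T p \<and> int (p ^ e p) dvd x - \<tau> p x"
    by metis
  \<comment> \<open>The joint class of \<open>x\<close>: its chosen representatives at all primes.
    Restricting the function to the prime factors places it in a finite product of at most
    \<open>d ^ card (prime_factors D)\<close> elements.\<close>
  define \<sigma> where "\<sigma> = (\<lambda>x. \<lambda>p\<in>prime_factors D. \<tau> p x)"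
  have fibre: "real (card {x \<in> X. \<sigma> x = b}) \<le> real d * (4 * (real d + 1) * h + 1)" for b
  proof -
    define Y where "Y = {x \<in> X. \<sigma> x = b}"
    have Y: "finite Y" "Y \<subseteq> X" using assms(1) by (auto simp: Y_def)
    have cong: "int M dvd x - z" if "x \<in> Y" "z \<in> Y" for x z
      unfolding M_def
    proof (rule root_ceil_dvd)
      fix p assume p: "p \<in> prime_factors D"
      have "\<sigma> x p = \<sigma> z p" using that by (simp add: Y_def)
      then have "\<tau> p x = \<tau> p z" using p by (simp add: \<sigma>_def)
      then have "int (p ^ e p) dvd x - \<tau> p x" "int (p ^ e p) dvd z - \<tau> p x"
        using \<tau>[OF p, of x] \<tau>[OF p, of z] that Y by auto
      then have "int (p ^ e p) dvd (x - \<tau> p x) - (z - \<tau> p x)"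
        by (rule dvd_diff)
      then show "int (p ^ ((multiplicity p D + d - 1) div d)) dvd x - z"
        by (simp add: e_def)
    qed
    have "\<exists>x\<in>S. \<exists>z\<in>S. x \<noteq> z \<and> \<bar>real_of_int (x - z)\<bar> \<le> s" if S: "S \<subseteq> Y" "card S = d + 1" for S
    proof (rule divdiff_nodes_close_real[OF _ S(2) s])
      show "finite S" using S Y finite_subset by blast
      show "\<bar>real_of_int (y x)\<bar> \<le> H" if "x \<in> S" for x using y that S Y by auto
      have "2 * (real d + 1) \<le> (2 * (real d + 1)) ^ d"
        using \<open>d > 0\<close> by (intro self_le_power) auto
      moreover have "real D \<le> real M ^ d" using M by (metis of_nat_le_iff of_nat_power)
      ultimately have "2 * (real d + 1) * H * real D \<le> (2 * (real d + 1)) ^ d * h ^ d * real M ^ d"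
        unfolding h using \<open>H \<ge> 1\<close> by (intro mult_mono) auto
      then have "2 * (real d + 1) * H * real D \<le> s ^ d"
        by (simp only: s_def power_mult_distrib)
      then have "real A * (2 * (real d + 1) * H) \<le> real A * (s ^ d / real D)"
        using \<open>D > 0\<close> by (intro mult_left_mono) (auto simp: field_simps)
      moreover have "1 * (2 * (real d + 1) * H) \<le> real A * (2 * (real d + 1) * H)"
        using \<open>A > 0\<close> \<open>H \<ge> 1\<close> by (intro mult_right_mono) auto
      moreover have "(real d + 1) * H > 0" using \<open>H \<ge> 1\<close> by simp
      ultimately have "(real d + 1) * H < real A * (s ^ d / real D)"
        by linarith
      moreover have "S \<subseteq> X" using S Y by blast
      ultimately show "(real d + 1) * H < \<bar>divdiff S (\<lambda>x. real_of_int (y x))\<bar> * s ^ d"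
        using c[OF _ S(2)] by simp
    qed
    moreover have "reflp (\<lambda>x z. \<bar>real_of_int (x - z)\<bar> \<le> s)" using s by (auto intro: reflpI)
    moreover have "symp (\<lambda>x z. \<bar>real_of_int (x - z)\<bar> \<le> s)" by (auto intro!: sympI)
    ultimately obtain R where R: "R \<subseteq> Y" "card R \<le> d" "\<And>x. x \<in> Y \<Longrightarrow> \<exists>t\<in>R. \<bar>real_of_int (x - t)\<bar> \<le> s"
      using exists_covering_set[OF \<open>finite Y\<close>, of "\<lambda>x z. \<bar>real_of_int (x - z)\<bar> \<le> s" d] by metis
    then obtain \<rho> where \<rho>: "\<And>x. x \<in> Y \<Longrightarrow> \<rho> x \<in> R \<and> \<bar>real_of_int (x - \<rho> x)\<bar> \<le> s" by metis
    have "real (card Y) \<le> real (card R) * (2 * s / real M + 1)"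
    proof (rule card_le_by_fibres)
      show "finite R" using R Y finite_subset by blast
      show "\<rho> ` Y \<subseteq> R" using \<rho> by auto
      show "real (card {x \<in> Y. \<rho> x = t}) \<le> 2 * s / real M + 1" for t
        using Y M s \<rho> cong by (intro card_residue_class_in_interval[of _ _ _ t]) auto
    qed
    also have "\<dots> \<le> real d * (2 * s / real M + 1)"
      using R(2) s by (intro mult_right_mono) auto
    also have "2 * s / real M = 4 * (real d + 1) * h"
      using M by (simp add: s_def)
    finally show ?thesis by (simp add: Y_def)
  qed
  have finT: "finite (T p)" if "p \<in> prime_factors D" for p
    using T[OF that] assms(1) finite_subset by blast
  have "real (card X) \<le> real (card (Pi\<^sub>E (prime_factors D) T)) * (real d * (4 * (real d + 1) * h + 1))"
  proof (rule card_le_by_fibres)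
    show "finite (Pi\<^sub>E (prime_factors D) T)" using finT by (intro finite_PiE) auto
    show "\<sigma> ` X \<subseteq> Pi\<^sub>E (prime_factors D) T" using \<tau> by (auto simp: \<sigma>_def)
  qed (rule fibre)
  also have "\<dots> \<le> real (d ^ card (prime_factors D)) * (real d * (4 * (real d + 1) * h + 1))"
  proof (intro mult_right_mono)
    have "card (Pi\<^sub>E (prime_factors D) T) = (\<Prod>p\<in>prime_factors D. card (T p))"
      by (simp add: card_PiE)
    also have "\<dots> \<le> (\<Prod>p\<in>prime_factors D. d)" using T by (intro prod_mono) auto
    finally show "real (card (Pi\<^sub>E (prime_factors D) T)) \<le> real (d ^ card (prime_factors D))"
      by (simp del: of_nat_power)
  qed (use h in auto)
  finally show ?thesis by (simp add: h_def)
qed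

text \<open>A prime \<open>p \<ge> N\<close> satisfies \<open>d \<le> p powr \<delta>\<close> and
  pays for its own factor \<open>d\<close>. Fewer than \<open>N + 1\<close> primes are smaller, and
  they cost at most \<open>d ^ N\<close>.\<close>

lemma power_omega_bound:
  fixes d :: nat and \<delta> :: real
  assumes "\<delta> > 0" "d > 0"
  obtains C where "C > 0" "\<And>D::nat. D > 0 \<Longrightarrow> real d ^ card (prime_factors D) \<le> C * real D powr \<delta>"
proof -
  define N where "N = nat \<lceil>real d powr (1 / \<delta>)\<rceil>"
  show thesis
  proof (rule that[of "real d ^ N"])
    fix D :: nat assume "D > 0"
    define P where "P = prime_factors D"
    have P: "finite P" "\<And>p. p \<in> P \<Longrightarrow> p > 0" by (auto simp: P_def dest: in_prime_factors_imp_prime intro: prime_gt_0_nat)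
    have "real d ^ card P = (\<Prod>p\<in>P. real d)" by simp
    also have "\<dots> \<le> (\<Prod>p\<in>P. (if p < N then real d else 1) * real (p ^ multiplicity p D) powr \<delta>)"
    proof (intro prod_mono conjI)
      fix p assume p: "p \<in> P"
      then have "multiplicity p D > 0" by (auto simp: P_def prime_factors_multiplicity)
      then have "p \<le> p ^ multiplicity p D" using P(2)[OF p] by (intro self_le_power) auto
      then have pp: "real p powr \<delta> \<le> real (p ^ multiplicity p D) powr \<delta>"
        using assms by (intro powr_mono2) (auto simp del: of_nat_power)
      have p1: "1 \<le> real p powr \<delta>" using P(2)[OF p] assms by (intro ge_one_powr_ge_zero) auto
      show "real d \<le> (if p < N then real d else 1) * real (p ^ multiplicity p D) powr \<delta>"
      proof (cases "p < N")
        case True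
        have "real d * 1 \<le> real d * real (p ^ multiplicity p D) powr \<delta>"
          using pp p1 by (intro mult_left_mono) auto
        then show ?thesis using True by simp
      next
        case False
        then have "real d powr (1 / \<delta>) \<le> real p"
          by (auto simp: N_def not_less nat_le_iff ceiling_le_iff)
        then have "(real d powr (1 / \<delta>)) powr \<delta> \<le> real p powr \<delta>"
          using assms by (intro powr_mono2) auto
        then show ?thesis using False pp assms by (simp add: powr_powr)
      qed
    qed auto
    also have "\<dots> = (\<Prod>p\<in>P. if p < N then real d else 1) * (\<Prod>p\<in>P. real (p ^ multiplicity p D) powr \<delta>)"
      by (rule prod.distrib)
    also have "(\<Prod>p\<in>P. real (p ^ multiplicity p D) powr \<delta>) = real (\<Prod>p\<in>P. p ^ multiplicity p D) powr \<delta>"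
      unfolding of_nat_prod by (rule prod_powr_distrib[symmetric])
    also have "(\<Prod>p\<in>P. p ^ multiplicity p D) = D"
      using \<open>D > 0\<close> by (simp add: P_def prod_prime_factors)
    also have "(\<Prod>p\<in>P. if p < N then real d else 1) = real d ^ card {p \<in> P. p < N}"
      using P by (simp add: prod.inter_filter[symmetric])
    also have "\<dots> * real D powr \<delta> \<le> real d ^ N * real D powr \<delta>"
    proof -
      have "card {p \<in> P. p < N} \<le> card {..<N}" by (intro card_mono) auto
      then show ?thesis using assms by (intro mult_right_mono power_increasing) auto
    qed
    finally show "real d ^ card (prime_factors D) \<le> real d ^ N * real D powr \<delta>"
      by (simp add: P_def)
  qed (use assms in auto)
qed

section \<open>Points of the curve in a narrow strip\<close>

text \<open>Proved over the reals but stated over the integers, so that it can be reduced modulo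
  \<open>q\<close>: the polynomial part vanishes on \<open>d + 2\<close> nodes and leaves the top
  coefficient on \<open>d + 1\<close>.\<close>

lemma sum_cofactor_poly:
  assumes "finite S" "d < card S"
  shows "(\<Sum>x\<in>S. cofactor S x * (\<Sum>i\<le>d. b i * x ^ i)) =
    (if card S = d + 1 then diffprod S * b d else 0)"
proof -
  have "real_of_int (\<Sum>x\<in>S. cofactor S x * (\<Sum>i\<le>d. b i * x ^ i)) =
      real_of_int (diffprod S) * divdiff S (\<lambda>x. \<Sum>i\<le>d. real_of_int (b i) * real_of_int x ^ i)"
    using diffprod_mult_divdiff_int[OF assms(1), of "\<lambda>x. \<Sum>i\<le>d. b i * x ^ i"] by simp
  also have "\<dots> = real_of_int (if card S = d + 1 then diffprod S * b d else 0)"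
    by (subst divdiff_poly[OF assms]) simp
  finally show ?thesis by (simp only: of_int_eq_iff)
qed

text \<open>
  Here \<open>y\<close> and \<open>b\<close> are the ordinates and the coefficients after translating the square to \<open>L = 0\<close>.
  The width \<open>H / (d + 3)\<close> makes the sum of the \<open>d + 2\<close> terms of a divided difference strictly
  smaller than \<open>q\<close>.
\<close>

definition narrow_arc ::
  "nat \<Rightarrow> int \<Rightarrow> (nat \<Rightarrow> int) \<Rightarrow> (int \<Rightarrow> int) \<Rightarrow> real \<Rightarrow> int set \<Rightarrow> bool" where
  "narrow_arc d q b y H X \<longleftrightarrow>
     finite X \<and> H \<ge> 1 \<and> H ^ ((d + 1 choose 2) + 1) \<le> real_of_int q \<and> coprime (b d) q \<and>
     (\<forall>x\<in>X. q dvd y x - (\<Sum>i\<le>d. b i * x ^ i)) \<and>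
     (\<forall>x\<in>X. \<bar>real_of_int (y x)\<bar> \<le> H) \<and>
     (\<forall>x\<in>X. \<forall>z\<in>X. \<bar>real_of_int (x - z)\<bar> \<le> H / (real d + 3))"

lemma narrow_arc_divdiff_constant:
  assumes "d > 0" "narrow_arc d q b y H X" "card X > d"
  obtains A D :: nat where "A > 0" "D > 0" "coprime A D" "real D \<le> H ^ (d + 1 choose 2)"
    "\<forall>S\<subseteq>X. card S = d + 1 \<longrightarrow> \<bar>divdiff S (\<lambda>x. real_of_int (y x))\<bar> = real A / real D"
proof -
  have "finite X" "H \<ge> 1" "H ^ ((d + 1 choose 2) + 1) \<le> real_of_int q" "coprime (b d) q"
    and y: "\<And>x. x \<in> X \<Longrightarrow> q dvd y x - (\<Sum>i\<le>d. b i * x ^ i)"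
    and yH: "\<And>x. x \<in> X \<Longrightarrow> \<bar>real_of_int (y x)\<bar> \<le> H"
    and narrow: "\<And>x z. x \<in> X \<Longrightarrow> z \<in> X \<Longrightarrow> \<bar>real_of_int (x - z)\<bar> \<le> H / (real d + 3)"
    using assms(2) unfolding narrow_arc_def by blast+
  define n where "n = (d + 1 choose 2)"
  have Hq: "H ^ (n + 1) \<le> real_of_int q" unfolding n_def by fact
  define B where "B = H / (real d + 3)"
  define E where "E = (\<lambda>S. \<Sum>x\<in>S. cofactor S x * y x)"
  have n: "n > 0" using \<open>d > 0\<close> by (simp add: n_def zero_less_binomial_iff)
  have B: "0 < B" "B \<le> H" using \<open>H \<ge> 1\<close> by (auto simp: B_def field_simps)
  have B': "B ^ n \<le> H ^ n / (real d + 3)"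
  proof -
    have "(real d + 3) ^ 1 \<le> (real d + 3) ^ n" using n by (intro power_increasing) auto
    then have "H ^ n / (real d + 3) ^ n \<le> H ^ n / (real d + 3)"
      using \<open>H \<ge> 1\<close> by (intro divide_left_mono) auto
    then show ?thesis by (simp add: B_def power_divide)
  qed
  have dp: "real_of_int (diffprod S) \<le> B ^ n" if "S \<subseteq> X" "card S = d + 1" for S
    using diffprod_le[of S B] that B narrow finite_subset[OF that(1) \<open>finite X\<close>]
    by (auto simp: n_def B_def)
  have Eeq: "real_of_int (E S) = real_of_int (diffprod S) * divdiff S (\<lambda>x. real_of_int (y x))"
    if "S \<subseteq> X" for S
    using diffprod_mult_divdiff_int[of S y] finite_subset[OF that \<open>finite X\<close>] by (simp add: E_def)
  have Edvd: "q dvd E S - (\<Sum>x\<in>S. cofactor S x * (\<Sum>i\<le>d. b i * x ^ i))" if "S \<subseteq> X" for S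
  proof -
    have "E S - (\<Sum>x\<in>S. cofactor S x * (\<Sum>i\<le>d. b i * x ^ i)) =
        (\<Sum>x\<in>S. cofactor S x * (y x - (\<Sum>i\<le>d. b i * x ^ i)))"
      by (simp add: E_def sum_subtractf right_diff_distrib)
    also have "q dvd \<dots>" using y that by (intro dvd_sum dvd_mult) auto
    finally show ?thesis .
  qed
  \<comment> \<open>\<open>E S\<close> is a multiple of \<open>q\<close>. Its \<open>d + 2\<close>
    terms are each at most \<open>B ^ n * H\<close>, and \<open>B ^ n\<close> supplies the factor
    \<open>1 / (d + 3)\<close> that makes the sum smaller than \<open>q\<close>.\<close>
  have vanish: "divdiff S (\<lambda>x. real_of_int (y x)) = 0" if S: "S \<subseteq> X" "card S = d + 2" for S
  proof -
    have fin: "finite S" using S \<open>finite X\<close> finite_subset by blast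
    have "q dvd E S" using Edvd[OF S(1)] sum_cofactor_poly[OF fin, of d b] S by simp
    moreover have "\<bar>E S\<bar> < q"
    proof -
      have "\<bar>real_of_int (E S)\<bar> \<le> (\<Sum>x\<in>S. \<bar>real_of_int (cofactor S x) * real_of_int (y x)\<bar>)"
        unfolding E_def of_int_sum of_int_mult by (rule sum_abs)
      also have "\<dots> \<le> (\<Sum>x\<in>S. B ^ n * H)"
      proof (intro sum_mono)
        fix x assume x: "x \<in> S"
        have "real_of_int \<bar>cofactor S x\<bar> \<le> B ^ n"
          using dp[of "S - {x}"] S x fin by (simp add: abs_cofactor subset_insertI2 Diff_subset_conv)
        then show "\<bar>real_of_int (cofactor S x) * real_of_int (y x)\<bar> \<le> B ^ n * H"
          unfolding abs_mult using yH[of x] x S B by (intro mult_mono) auto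
      qed
      also have "\<dots> = (real d + 2) * (B ^ n * H)" using S by simp
      also have "\<dots> \<le> (real d + 2) * (H ^ n / (real d + 3) * H)"
        using B' \<open>H \<ge> 1\<close> by (intro mult_left_mono mult_right_mono) auto
      also have "\<dots> = (real d + 2) / (real d + 3) * H ^ (n + 1)" by simp
      also have "\<dots> < 1 * H ^ (n + 1)"
        using \<open>H \<ge> 1\<close> by (intro mult_strict_right_mono) auto
      also have "\<dots> \<le> real_of_int q" using Hq by simp
      finally show ?thesis by linarith
    qed
    ultimately have "E S = 0" using dvd_imp_le_int[of "E S" q] by linarith
    then show ?thesis using Eeq[OF S(1)] diffprod_pos[of S] by simp
  qed
  obtain S0 where S0: "S0 \<subseteq> X" "card S0 = d + 1"
    using obtain_subset_with_card_n[of "d + 1" X] \<open>card X > d\<close> by auto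
  have fin: "finite S0" using S0 \<open>finite X\<close> finite_subset by blast
  define c where "c = divdiff S0 (\<lambda>x. real_of_int (y x))"
  have const: "divdiff S (\<lambda>x. real_of_int (y x)) = c" if "S \<subseteq> X" "card S = d + 1" for S
    unfolding c_def using vanish that S0 by (intro divdiff_eq_if_next_vanishes[of X d]) auto
  have Vc: "real_of_int (E S0) = real_of_int (diffprod S0) * c"
    using Eeq[OF S0(1)] by (simp add: c_def)
  have VH: "real_of_int (diffprod S0) \<le> H ^ n"
    using dp[OF S0] power_mono[of B H n] B by linarith
  \<comment> \<open>Otherwise \<open>q\<close> would divide \<open>diffprod S0 * b d\<close>, hence
    \<open>diffprod S0\<close>, which is positive and smaller than \<open>q\<close>.\<close>
  have "c \<noteq> 0"
  proof
    assume "c = 0"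
    then have "E S0 = 0" using Vc by simp
    then have "q dvd diffprod S0 * b d"
      using Edvd[OF S0(1)] sum_cofactor_poly[OF fin, of d b] S0 by simp
    then have "q dvd diffprod S0"
      using \<open>coprime (b d) q\<close> by (simp add: coprime_dvd_mult_left_iff coprime_commute)
    then have "q \<le> diffprod S0" using diffprod_pos by (intro zdvd_imp_le) auto
    then have "real_of_int q \<le> B ^ n" using dp[OF S0] by linarith
    also have "\<dots> \<le> H ^ n / (real d + 3)" by (rule B')
    also have "\<dots> < H ^ n / 1" using \<open>H \<ge> 1\<close> by (intro divide_strict_left_mono) auto
    also have "\<dots> = H ^ n" by simp
    also have "\<dots> \<le> H ^ (n + 1)" using \<open>H \<ge> 1\<close> by (intro power_increasing) auto
    finally show False using Hq by simp
  qed
  have cq: "c = real_of_int (E S0) / real_of_int (diffprod S0)"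
    using Vc diffprod_pos[of S0] by (simp add: field_simps)
  then have "c \<in> \<rat>" by simp
  then obtain A D :: nat where AD: "D \<noteq> 0" "\<bar>c\<bar> = real A / real D" "coprime A D"
    by (rule Rats_abs_nat_div_natE)
  \<comment> \<open>In lowest terms \<open>D\<close> divides the common denominator
    \<open>diffprod S0\<close>, which bounds it by \<open>H ^ n\<close>.\<close>
  have "real A * real_of_int (diffprod S0) = real D * real_of_int \<bar>E S0\<bar>"
    using AD Vc diffprod_pos[of S0] by (simp add: abs_mult)
  then have "int A * diffprod S0 = int D * \<bar>E S0\<bar>"
    by (metis of_int_eq_iff of_int_mult of_int_of_nat_eq)
  then have "int D dvd int A * diffprod S0" by simp
  then have "int D dvd diffprod S0"
    using AD(3) by (simp add: coprime_dvd_mult_right_iff coprime_commute)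
  then have "int D \<le> diffprod S0" using diffprod_pos by (intro zdvd_imp_le) auto
  then have "real D \<le> H ^ n" using VH by linarith
  moreover have "A > 0" using AD \<open>c \<noteq> 0\<close> by (intro gr0I) auto
  ultimately show thesis
    using AD const by (intro that[of A D]) (auto simp: n_def)
qed

lemma narrow_arc_count_bound:
  fixes d :: nat and \<epsilon> :: real
  assumes "d > 0" "\<epsilon> > 0"
  obtains C where "C > 0"
    "\<forall>q b y H X. narrow_arc d q b y H X \<longrightarrow> real (card X) \<le> C * H powr (1 / real d + \<epsilon>)"
proof -
  define n where "n = (d + 1 choose 2)"
  have n: "n > 0" using \<open>d > 0\<close> by (simp add: n_def zero_less_binomial_iff)
  \<comment> \<open>Since \<open>D \<le> H ^ n\<close>, this exponent yields
    \<open>D powr \<delta> \<le> H powr \<epsilon>\<close>.\<close>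
  define \<delta> where "\<delta> = \<epsilon> / real n"
  have \<delta>: "\<delta> > 0" using n \<open>\<epsilon> > 0\<close> by (simp add: \<delta>_def)
  obtain C0 where C0: "C0 > 0" "\<And>D::nat. D > 0 \<Longrightarrow> real d ^ card (prime_factors D) \<le> C0 * real D powr \<delta>"
    using power_omega_bound[OF \<delta> \<open>d > 0\<close>] by metis
  \<comment> \<open>The last summand handles at most \<open>d\<close> abscissae, where there is no
    divided difference of order \<open>d\<close>.\<close>
  define C where "C = C0 * (real d * (4 * (real d + 1) + 1)) + real d"
  have "C > 0" using C0(1) by (auto simp: C_def intro!: add_nonneg_pos \<open>d > 0\<close>)
  moreover have "real (card X) \<le> C * H powr (1 / real d + \<epsilon>)" if arc: "narrow_arc d q b y H X" for q b y H X
  proof -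
    from arc have H: "H \<ge> 1" and fin: "finite X" and y: "\<And>x. x \<in> X \<Longrightarrow> \<bar>real_of_int (y x)\<bar> \<le> H"
      unfolding narrow_arc_def by blast+
    define h where "h = H powr (1 / real d)"
    have h: "h \<ge> 1" using H by (auto simp: h_def intro: ge_one_powr_ge_zero)
    have he: "h * H powr \<epsilon> = H powr (1 / real d + \<epsilon>)" by (simp add: h_def powr_add)
    have e1: "H powr \<epsilon> \<ge> 1" using H \<open>\<epsilon> > 0\<close> by (intro ge_one_powr_ge_zero) auto
    have "1 * 1 \<le> h * H powr \<epsilon>" using h e1 by (intro mult_mono) auto
    then have big: "1 \<le> H powr (1 / real d + \<epsilon>)" by (simp add: he)
    show ?thesis
    proof (cases "card X > d")
      case False
      then have "real (card X) \<le> real d * 1" by simp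
      also have "\<dots> \<le> C * H powr (1 / real d + \<epsilon>)"
        using big C0(1) by (intro mult_mono) (auto simp: C_def)
      finally show ?thesis .
    next
      case True
      obtain A D :: nat where AD: "A > 0" "D > 0" "coprime A D" "real D \<le> H ^ (d + 1 choose 2)"
        and c: "\<forall>S\<subseteq>X. card S = d + 1 \<longrightarrow> \<bar>divdiff S (\<lambda>x. real_of_int (y x))\<bar> = real A / real D"
        by (rule narrow_arc_divdiff_constant[OF \<open>d > 0\<close> arc True])
      have "real D powr \<delta> \<le> (H ^ n) powr \<delta>" using AD \<delta> by (intro powr_mono2) (auto simp: n_def)
      also have "\<dots> = H powr \<epsilon>"
        using H n by (simp add: \<delta>_def powr_powr flip: powr_realpow)
      finally have Dd: "real D powr \<delta> \<le> H powr \<epsilon>" .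
      have "real (card X) \<le> real d ^ card (prime_factors D) * (real d * (4 * (real d + 1) * h + 1))"
        unfolding h_def using fin \<open>d > 0\<close> H AD c y by (intro card_constant_divdiff[where A = A and y = y]) auto
      also have "\<dots> \<le> (C0 * H powr \<epsilon>) * (real d * (4 * (real d + 1) * h + h))"
      proof (intro mult_mono)
        show "real d ^ card (prime_factors D) \<le> C0 * H powr \<epsilon>"
          using C0(2)[OF AD(2)] mult_left_mono[OF Dd, of C0] C0(1) by linarith
      qed (use h C0 in auto)
      also have "\<dots> = C0 * (real d * (4 * (real d + 1) + 1)) * H powr (1 / real d + \<epsilon>)"
        unfolding he[symmetric] by (simp add: algebra_simps)
      also have "\<dots> \<le> C * H powr (1 / real d + \<epsilon>)"
        by (intro mult_right_mono) (auto simp: C_def)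
      finally show ?thesis .
    qed
  qed
  ultimately show thesis using that by blast
qed

section \<open>From the square to narrow strips\<close>

theorem theorem2:
  fixes d :: nat and \<epsilon> :: real
  assumes "d \<ge> 2" and "\<epsilon> > 0"
  shows "\<exists>C::real. \<forall>(q::int) (f::nat \<Rightarrow> int) (K::int) (L::int) (H::real).
           q > 0 \<longrightarrow>
           f \<in> carrier (UP (residue_ring q)) \<longrightarrow>
           deg (residue_ring q) f = d \<longrightarrow>
           coprime (residue_lead_coeff q f) q \<longrightarrow>
           H > 0 \<longrightarrow>
           H \<le> of_int q powr (2 / (real d ^ 2 + real d + 2)) \<longrightarrow>
           real (card (square_curve_points q f K L H)) \<le> C * H powr (1 / real d + \<epsilon>)"
proof -
  \<comment> \<open>As \<open>d ^ 2 + d + 2 = 2 * (n + 1)\<close>, the hypothesis on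
    \<open>H\<close> becomes \<open>H ^ (n + 1) \<le> q\<close>, the size condition of
    \<open>narrow_arc\<close>.\<close>
  define n where "n = (d + 1 choose 2)"
  have "2 * n = d * (d + 1)"
    by (simp add: n_def choose_two)
  then have "2 * real n = real d * (real d + 1)"
    by (metis of_nat_1 of_nat_add of_nat_mult of_nat_numeral)
  then have n: "real d ^ 2 + real d + 2 = 2 * real (n + 1)"
    by (simp add: power2_eq_square algebra_simps)
  have "d > 0" using \<open>d \<ge> 2\<close> by simp
  obtain C where C: "C > 0" and count:
    "\<forall>q b y H X. narrow_arc d q b y H X \<longrightarrow> real (card X) \<le> C * H powr (1 / real d + \<epsilon>)"
    by (rule narrow_arc_count_bound[OF \<open>d > 0\<close> \<open>\<epsilon> > 0\<close>])
  show ?thesis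
  \<comment> \<open>One \<open>C\<close> for each of the \<open>d + 4\<close> strips; the extra 1
    covers \<open>q = 1\<close>.\<close>
  proof (intro exI[of _ "(real d + 4) * C + 1"] allI impI)
    fix q :: int and f :: "nat \<Rightarrow> int" and K L :: int and H :: real
    assume q: "q > 0" and f: "f \<in> carrier (UP (residue_ring q))" "deg (residue_ring q) f = d"
      and lead: "coprime (residue_lead_coeff q f) q"
      and H: "H > 0" "H \<le> of_int q powr (2 / (real d ^ 2 + real d + 2))"
    define P where "P = square_curve_points q f K L H"
    have P: "real_of_int K < real_of_int x" "real_of_int x \<le> real_of_int K + H"
        "real_of_int L < real_of_int y" "real_of_int y \<le> real_of_int L + H"
        "y mod q = residue_poly_value q f x" if "(x, y) \<in> P" for x y
      using that by (auto simp: P_def square_curve_points_def half_open_square_def)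
    have "real (card P) \<le> ((real d + 4) * C + 1) * H powr (1 / real d + \<epsilon>)"
    proof (cases "H < 1")
      case True
      have "P = {}"
      proof (rule equals0I)
        fix z assume "z \<in> P"
        then obtain x y where "(x, y) \<in> P" by (cases z) auto
        from P(1,2)[OF this] True have "K < x" "x < K + 1" by linarith+
        then show False by simp
      qed
      then show ?thesis using C by simp
    next
      case False
      then have H1: "H \<ge> 1" by simp
      have big: "1 \<le> H powr (1 / real d + \<epsilon>)"
        using H1 \<open>\<epsilon> > 0\<close> by (intro ge_one_powr_ge_zero) auto
      have "H ^ (n + 1) = H powr real (n + 1)"
        using H by (simp only: powr_realpow)
      also have "\<dots> \<le> (of_int q powr (2 / (real d ^ 2 + real d + 2))) powr real (n + 1)"
        using H by (intro powr_mono2) auto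
      also have "\<dots> = real_of_int q"
        using q unfolding powr_powr n by simp
      finally have Hn: "H ^ (n + 1) \<le> real_of_int q" .
      have "H ^ 1 \<le> H ^ (n + 1)" using H1 by (intro power_increasing) auto
      then have Hq: "H \<le> real_of_int q" using Hn by simp
      \<comment> \<open>Two ordinates over one abscissa are congruent modulo \<open>q\<close> and
        differ by less than \<open>H \<le> q\<close>, so counting points means counting
        abscissae.\<close>
      have inj: "inj_on fst P"
      proof (rule inj_onI)
        fix u v assume uv: "u \<in> P" "v \<in> P" "fst u = fst v"
        then obtain x y y' where u: "u = (x, y)" and v: "v = (x, y')" by (metis prod.collapse)
        have "y mod q = y' mod q" using P(5) uv u v by metis
        then have "q dvd y - y'" by (simp add: mod_eq_dvd_iff)
        moreover have "\<bar>y - y'\<bar> < q"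
          using P(3,4)[OF uv(1)[unfolded u]] P(3,4)[OF uv(2)[unfolded v]] Hq by linarith
        ultimately have "y - y' = 0" using dvd_imp_le_int[of "y - y'" q] by linarith
        then show "u = v" using u v by simp
      qed
      define X where "X = fst ` P"
      have X: "real_of_int K < real_of_int x" "real_of_int x \<le> real_of_int K + H" if "x \<in> X" for x
        using that P by (auto simp: X_def)
      have "X \<subseteq> {K..K + \<lceil>H\<rceil>}"
      proof
        fix x assume "x \<in> X"
        from X[OF this] have "K \<le> x" "x \<le> K + \<lceil>H\<rceil>" by linarith+
        then show "x \<in> {K..K + \<lceil>H\<rceil>}" by simp
      qed
      then have finX: "finite X" by (rule finite_subset) simp
      have cardX: "card P = card X" using inj by (simp add: X_def card_image)
      show ?thesis
      proof (cases "q = 1")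
        \<comment> \<open>\<open>residue_poly_value_eq\<close> needs \<open>q > 1\<close>; here
          \<open>H \<le> 1\<close> leaves a single possible abscissa.\<close>
        case True
        have "x = K + 1" if "x \<in> X" for x using X[OF that] Hq True by auto
        then have "X \<subseteq> {K + 1}" by blast
        then have "card X \<le> card {K + 1}" by (intro card_mono) auto
        then have "real (card P) \<le> 1 * 1" by (simp add: cardX)
        also have "\<dots> \<le> ((real d + 4) * C + 1) * H powr (1 / real d + \<epsilon>)"
          using big C by (intro mult_mono) auto
        finally show ?thesis .
      next
        case False
        with q have "q > 1" by simp
        note value_eq = residue_poly_value_eq[OF this f(1), unfolded f(2)]
        have "f d = residue_lead_coeff q f"
          using f by (simp add: residue_lead_coeff_def UP_def)
        then have cop: "coprime (f d) q" using lead by simp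
        have "\<forall>x\<in>X. \<exists>y. (x, y) \<in> P" by (auto simp: X_def)
        then obtain Y where Y: "\<And>x. x \<in> X \<Longrightarrow> (x, Y x) \<in> P" by metis
        define y where "y = (\<lambda>x. Y x - L)"
        \<comment> \<open>The shift by \<open>L\<close> is absorbed by the constant coefficient; as
          \<open>d > 0\<close>, the leading one is unchanged.\<close>
        define b where "b = f(0 := f 0 - L)"
        have bsum: "(\<Sum>i\<le>d. b i * x ^ i) = (\<Sum>i\<le>d. f i * x ^ i) - L" for x
          by (simp add: b_def sum.atMost_shift)
        have y: "q dvd y x - (\<Sum>i\<le>d. b i * x ^ i)" if "x \<in> X" for x
        proof -
          have "Y x mod q = (\<Sum>i\<le>d. f i * x ^ i) mod q"
            using P(5)[OF Y[OF that]] value_eq by simp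
          then show ?thesis by (simp add: y_def bsum mod_eq_dvd_iff)
        qed
        have yH: "\<bar>real_of_int (y x)\<bar> \<le> H" if "x \<in> X" for x
          using P(3,4)[OF Y[OF that]] by (simp add: y_def)
        \<comment> \<open>The index of the strip containing \<open>x\<close>. The value
          \<open>d + 3\<close> occurs only at the closed right end \<open>x = K + H\<close>, hence
          \<open>d + 4\<close> indices.\<close>
        define \<tau> where "\<tau> = (\<lambda>x::int. \<lfloor>real_of_int (x - K) * (real d + 3) / H\<rfloor>)"
        have "real (card X) \<le> real (card {0..int d + 3}) * (C * H powr (1 / real d + \<epsilon>))"
        proof (rule card_le_by_fibres)
          show "\<tau> ` X \<subseteq> {0..int d + 3}"
          proof (intro image_subsetI)
            fix x assume "x \<in> X"
            note x = X[OF this]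
            have "real_of_int (x - K) * (real d + 3) \<le> H * (real d + 3)"
              using x by (intro mult_right_mono) auto
            then have "real_of_int (x - K) * (real d + 3) / H \<le> real d + 3"
              using H by (simp add: field_simps)
            moreover have "0 \<le> real_of_int (x - K) * (real d + 3) / H"
              using x H by (intro divide_nonneg_pos mult_nonneg_nonneg) auto
            ultimately show "\<tau> x \<in> {0..int d + 3}"
              by (simp add: \<tau>_def floor_le_iff)
          qed
        next
          fix t
          have "\<bar>real_of_int (x - z)\<bar> \<le> H / (real d + 3)" if "\<tau> x = \<tau> z" for x z
          proof -
            from that have "\<bar>real_of_int (x - K) * (real d + 3) / H - real_of_int (z - K) * (real d + 3) / H\<bar> \<le> 1"
              unfolding \<tau>_def by linarith
            also have "real_of_int (x - K) * (real d + 3) / H - real_of_int (z - K) * (real d + 3) / H =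
                real_of_int (x - z) * ((real d + 3) / H)"
              by (simp add: algebra_simps add_divide_distrib diff_divide_distrib)
            finally have "\<bar>real_of_int (x - z)\<bar> * ((real d + 3) / H) \<le> 1"
              using H by (simp add: abs_mult)
            then show ?thesis
              using H by (simp add: field_simps)
          qed
          then have "narrow_arc d q b y H {x \<in> X. \<tau> x = t}"
            using H1 Hn cop y yH finX \<open>d > 0\<close> unfolding narrow_arc_def
            by (auto simp: n_def b_def simp del: power_add)
          then show "real (card {x \<in> X. \<tau> x = t}) \<le> C * H powr (1 / real d + \<epsilon>)"
            using count by blast
        qed simp
        also have "\<dots> \<le> ((real d + 4) * C + 1) * H powr (1 / real d + \<epsilon>)"
          by (simp add: algebra_simps)
        finally show ?thesis by (simp add: cardX)
      qed
    qed
    then show "real (card (square_curve_points q f K L H)) \<le>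
        ((real d + 4) * C + 1) * H powr (1 / real d + \<epsilon>)"
      by (simp add: P_def)
  qed
qed

end
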